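(* Let $(\bar x,\bar u)\in\mathbb S^p_+\times\mathcal P$ be an optimal solution to the primal problem $$\min\ \tfrac12\langle x,\mathcal Qx\rangle+\langle c,x\rangle\quad\text{s.t.}\quad \mathcal Ax=b,\ x-u=0,\ x\in\mathbb S^p_+,\ u\in\mathcal P.$$ If $\Lambda_P(\bar x,\bar u)=\{(\bar s,\bar y,\bar z,\bar v)\}$, then the following two conditions are equivalent: (i) The second-order sufficient optimality condition for the primal problem holds at $(\bar x,\bar u)$: $$\langle\mathcal Qd_x,d_x\rangle+2\langle\bar s,d_x\bar x^\dagger d_x\rangle>0,\quad\forall\,0\ne(d_x,d_u)\in\mathcal C(\bar x,\bar u).$$ (ii) The SRCQ for the dual problem holds at $(\bar s,\bar y,\bar z,\bar v)$ with respect to $(\bar x,\bar u)$: $$T_{\mathbb S^p_+}(\bar s)\cap\bar x^\perp+S_{\bar x,\bar z}+\mathcal A^*\mathbb R^m-\mathcal Q\mathcal W=\mathbb S^p.$$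
   Context: $\mathbb S^p$: $p\times p$ real symmetric matrices with trace inner product; $\mathbb S^p_+$ the positive semi-definite cone, $\mathbb S^p_-=-\mathbb S^p_+$. $\mathcal Q:\mathbb S^p\to\mathbb S^p$ is self-adjoint positive semi-definite linear, $\mathcal A:\mathbb S^p\to\mathbb R^m$ linear, $c\in\mathbb S^p$, $b\in\mathbb R^m$, $\mathcal P\subset\mathbb S^p$ a nonempty convex polyhedral set, and $\mathcal W\subseteq\mathbb S^p$ is any linear subspace containing $\mathrm{Range}\,\mathcal Q$. $T$, $N$: tangent and normal cones of convex analysis; $v^\perp=\{d:\langle d,v\rangle=0\}$; $\dagger$: Moore–Penrose pseudo-inverse; $\delta^*_{\mathcal P}$: support function of $\mathcal P$; $\theta(z):=\delta^*_{\mathcal P}(-z)$, $\theta'(z;u)$ its directional derivative. The dual problem is $\max\ \langle b,y\rangle-\frac12\langle w,\mathcal Qw\rangle-\delta^*_{\mathcal P}(-z)$ s.t. $s+\mathcal A^*y-\mathcal Qw+z=c$, $s\in\mathbb S^p_+$, $w\in\mathcal W$. SRCQ stands for strict Robinson constraint qualification. $\Lambda_P(\bar x,\bar u)$ is the set of $(s,y,z,v)\in\mathbb S^p\times\mathbb R^m\times\mathbb S^p\times\mathbb S^p$ with $\mathcal Q\bar x+c-\mathcal A^*y-z-s=0$, $z+v=0$, $b-\mathcal A\bar x=0$, $\bar u-\bar x=0$, $s\in N_{\mathbb S^p_-}(-\bar x)$, $v\in N_{\mathcal P}(\bar u)$. Critical cone: $\mathcal C(\bar x,\bar u)=\{(d_x,d_u)\in\mathbb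 S^p\times\mathbb S^p:\mathcal Ad_x=0,\ d_u-d_x=0,\ d_x\in T_{\mathbb S^p_+}(\bar x),\ d_u\in T_{\mathcal P}(\bar u),\ \langle\mathcal Q\bar x+c,d_x\rangle=0\}$. $S_{x,z}:=\{u\in\mathbb S^p:\langle u,x\rangle+\theta'(z;u)=0\}$. *)

theory Defs
  imports "HOL-Analysis.Analysis"
begin

section \<open>The Euclidean space of real symmetric matrices\<close>

typedef (overloaded) ('p::finite) symmat = "{X :: real ^ 'p ^ 'p. transpose X = X}"
  morphisms mat_of Sym
  by (rule exI [of _ 0]) (simp add: transpose_def vec_eq_iff)

lemma transpose_mat_of [simp]: "transpose (mat_of X) = mat_of X"
  using mat_of by auto

instantiation symmat :: (finite) real_vector
begin

definition zero_symmat :: "'a symmat" where "zero_symmat = Sym 0"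
definition plus_symmat :: "'a symmat \<Rightarrow> 'a symmat \<Rightarrow> 'a symmat"
  where "plus_symmat X Y = Sym (mat_of X + mat_of Y)"
definition minus_symmat :: "'a symmat \<Rightarrow> 'a symmat \<Rightarrow> 'a symmat"
  where "minus_symmat X Y = Sym (mat_of X - mat_of Y)"
definition uminus_symmat :: "'a symmat \<Rightarrow> 'a symmat"
  where "uminus_symmat X = Sym (- mat_of X)"
definition scaleR_symmat :: "real \<Rightarrow> 'a symmat \<Rightarrow> 'a symmat"
  where "scaleR_symmat r X = Sym (r *\<^sub>R mat_of X)"

lemma mat_of_zero [simp]: "mat_of 0 = 0"
  unfolding zero_symmat_def by (subst Sym_inverse) (auto simp: transpose_def vec_eq_iff)

lemma mat_of_add [simp]: "mat_of (X + Y) = mat_of X + mat_of Y"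
  unfolding plus_symmat_def using transpose_mat_of [of X] transpose_mat_of [of Y]
  by (subst Sym_inverse) (auto simp: transpose_def vec_eq_iff simp del: transpose_mat_of)

lemma mat_of_diff [simp]: "mat_of (X - Y) = mat_of X - mat_of Y"
  unfolding minus_symmat_def using transpose_mat_of [of X] transpose_mat_of [of Y]
  by (subst Sym_inverse) (auto simp: transpose_def vec_eq_iff simp del: transpose_mat_of)

lemma mat_of_uminus [simp]: "mat_of (- X) = - mat_of X"
  unfolding uminus_symmat_def using transpose_mat_of [of X]
  by (subst Sym_inverse) (auto simp: transpose_def vec_eq_iff simp del: transpose_mat_of)

lemma mat_of_scaleR [simp]: "mat_of (r *\<^sub>R X) = r *\<^sub>R mat_of X"
  unfolding scaleR_symmat_def using transpose_mat_of [of X]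
  by (subst Sym_inverse) (auto simp: transpose_def vec_eq_iff simp del: transpose_mat_of)

instance
  by standard (auto simp: mat_of_inject [symmetric] algebra_simps)

end

lemma trace_mult_eq_inner:
  "trace (M ** mat_of Y) = inner M (mat_of Y)"
proof -
  have "mat_of Y $ k $ i = transpose (mat_of Y) $ i $ k" for i k
    by (simp only: transpose_def vec_lambda_beta)
  then show ?thesis
    by (simp add: trace_def matrix_matrix_mult_def inner_vec_def)
qed

instantiation symmat :: (finite) real_inner
begin

definition inner_symmat :: "'a symmat \<Rightarrow> 'a symmat \<Rightarrow> real"
  where "inner_symmat X Y = trace (mat_of X ** mat_of Y)"
definition norm_symmat :: "'a symmat \<Rightarrow> real"
  where "norm_symmat X = sqrt (inner X X)"
definition dist_symmat :: "'a symmat \<Rightarrow> 'a symmat \<Rightarrow> real"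
  where "dist_symmat X Y = norm (X - Y)"
definition sgn_symmat :: "'a symmat \<Rightarrow> 'a symmat"
  where "sgn_symmat X = X /\<^sub>R norm X"
definition uniformity_symmat :: "('a symmat \<times> 'a symmat) filter"
  where "uniformity_symmat = (INF e\<in>{0<..}. principal {(X, Y). dist X Y < e})"
definition open_symmat :: "'a symmat set \<Rightarrow> bool"
  where "open_symmat U \<longleftrightarrow> (\<forall>X\<in>U. \<forall>\<^sub>F (X', Y) in uniformity. X' = X \<longrightarrow> Y \<in> U)"

instance
proof
  fix X Y Z :: "'a symmat" and r :: real
  show "dist X Y = norm (X - Y)" by (rule dist_symmat_def)
  show "sgn X = X /\<^sub>R norm X" by (rule sgn_symmat_def)
  show "(uniformity :: ('a symmat \<times> 'a symmat) filter) =
      (INF e\<in>{0<..}. principal {(X, Y). dist X Y < e})" by (rule uniformity_symmat_def)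
  show "open U \<longleftrightarrow> (\<forall>X\<in>U. \<forall>\<^sub>F (X', Y) in uniformity. X' = X \<longrightarrow> Y \<in> U)"
    for U :: "'a symmat set" by (rule open_symmat_def)
  show "inner X Y = inner Y X"
    unfolding inner_symmat_def trace_mult_eq_inner by (rule inner_commute)
  show "inner (X + Y) Z = inner X Z + inner Y Z"
    unfolding inner_symmat_def trace_mult_eq_inner mat_of_add by (rule inner_add_left)
  show "inner (r *\<^sub>R X) Y = r * inner X Y"
    unfolding inner_symmat_def trace_mult_eq_inner mat_of_scaleR by (rule inner_scaleR_left)
  show "0 \<le> inner X X"
    unfolding inner_symmat_def trace_mult_eq_inner by (rule inner_ge_zero)
  show "inner X X = 0 \<longleftrightarrow> X = 0"
    unfolding inner_symmat_def trace_mult_eq_inner inner_eq_zero_iff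
    by (simp flip: mat_of_inject)
  show "norm X = sqrt (inner X X)" by (rule norm_symmat_def)
qed

end

lemma inner_symmat: "inner X Y = inner (mat_of X) (mat_of Y)"
  by (simp add: inner_symmat_def trace_mult_eq_inner)

definition symmat_onb :: "('p::finite) symmat set \<Rightarrow> bool"
  where "symmat_onb B \<longleftrightarrow> B \<noteq> {} \<and> finite B \<and>
    (\<forall>u\<in>B. \<forall>v\<in>B. inner u v = (if u = v then 1 else 0)) \<and>
    (\<forall>x. (\<forall>u\<in>B. inner x u = 0) \<longleftrightarrow> x = 0)"

lemma symmat_onb_exists: "\<exists>B :: ('p::finite) symmat set. symmat_onb B"
proof -
  let ?S = "{X :: real ^ 'p ^ 'p. transpose X = X}"
  have S: "subspace ?S"
    by (auto simp: subspace_def transpose_def vec_eq_iff)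
  obtain B where B: "B \<subseteq> ?S" "pairwise orthogonal B" "\<And>x. x \<in> B \<Longrightarrow> norm x = 1"
    "independent B" "card B = dim ?S" "span B = ?S"
    by (rule orthonormal_basis_subspace [OF S]) (rule that)
  have fin: "finite B" by (rule independent_imp_finite [OF B(4)])
  have m: "mat_of (Sym u) = u" if "u \<in> B" for u
    using that B(1) by (intro Sym_inverse) (rule subsetD)
  have "symmat_onb (Sym ` B)"
    unfolding symmat_onb_def
  proof (intro conjI ballI allI)
    show "Sym ` B \<noteq> {}"
    proof
      assume "Sym ` B = {}"
      then have "?S = {0}" using B(6) by simp
      moreover have "(mat 1 :: real ^ 'p ^ 'p) \<in> ?S" by simp
      ultimately have "(mat 1 :: real ^ 'p ^ 'p) = 0" by auto
      then have "(mat 1 :: real ^ 'p ^ 'p) $ i $ i = 0" for i by simp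
      then show False by (simp add: mat_def)
    qed
    show "finite (Sym ` B)" using fin by simp
    fix u v assume "u \<in> Sym ` B" "v \<in> Sym ` B"
    then obtain u' v' where uv: "u = Sym u'" "v = Sym v'" "u' \<in> B" "v' \<in> B" by auto
    have eq: "u = v \<longleftrightarrow> u' = v'" using uv m by metis
    show "inner u v = (if u = v then 1 else 0)"
    proof (cases "u' = v'")
      case True
      then show ?thesis using B(3)[OF uv(3)] uv m eq
        by (simp add: inner_symmat norm_eq_1)
    next
      case False
      then have "orthogonal u' v'" using B(2) uv by (auto simp: pairwise_def)
      then show ?thesis using False uv m eq by (simp add: inner_symmat orthogonal_def)
    qed
  next
    fix x :: "'p symmat"
    show "(\<forall>u\<in>Sym ` B. inner x u = 0) \<longleftrightarrow> x = 0"
    proof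
      assume "\<forall>u\<in>Sym ` B. inner x u = 0"
      then have "orthogonal (mat_of x) u" if "u \<in> B" for u
        using that m by (auto simp: inner_symmat orthogonal_def)
      moreover have "mat_of x \<in> span B" using B(6) by simp
      ultimately have "orthogonal (mat_of x) (mat_of x)"
        by (rule orthogonal_to_span [rotated])
      then show "x = 0" by (simp add: orthogonal_self mat_of_inject [symmetric])
    qed simp
  qed
  then show ?thesis by blast
qed

instantiation symmat :: (finite) euclidean_space
begin

definition Basis_symmat :: "'a symmat set" where "Basis_symmat = (SOME B. symmat_onb B)"

instance
proof -
  have *: "symmat_onb (Basis :: 'a symmat set)"
    unfolding Basis_symmat_def by (rule someI_ex [OF symmat_onb_exists])
  show "OFCLASS('a symmat, euclidean_space_class)"
    by standard (use * in \<open>unfold symmat_onb_def, blast+\<close>)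
qed

end

definition psd_cone :: "('p::finite) symmat set"
  where "psd_cone = {X. \<forall>v. 0 \<le> inner v (mat_of X *v v)}"

definition nsd_cone :: "('p::finite) symmat set"
  where "nsd_cone = uminus ` psd_cone"

definition is_pseudo_inverse :: "real ^ 'n ^ 'm \<Rightarrow> real ^ 'm ^ 'n \<Rightarrow> bool"
  where "is_pseudo_inverse M X \<longleftrightarrow>
    M ** X ** M = M \<and> X ** M ** X = X \<and>
    transpose (M ** X) = M ** X \<and> transpose (X ** M) = X ** M"

definition pseudo_inverse :: "real ^ 'n ^ 'm \<Rightarrow> real ^ 'm ^ 'n"
  where "pseudo_inverse M = (THE X. is_pseudo_inverse M X)"


section \<open>Convex analysis\<close>

text \<open>Both cones are empty at points outside the set.\<close>

definition normal_cone :: "'a::euclidean_space set \<Rightarrow> 'a \<Rightarrow> 'a set"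
  where "normal_cone C x = (if x \<in> C then {v. \<forall>y\<in>C. inner v (y - x) \<le> 0} else {})"

definition tangent_cone :: "'a::euclidean_space set \<Rightarrow> 'a \<Rightarrow> 'a set"
  where "tangent_cone C x =
    (if x \<in> C then closure {t *\<^sub>R (y - x) | t y. 0 \<le> t \<and> y \<in> C} else {})"

definition orth_compl :: "'a::euclidean_space \<Rightarrow> 'a set"
  where "orth_compl v = {d. inner d v = 0}"

definition support_fun :: "'a::euclidean_space set \<Rightarrow> 'a \<Rightarrow> ereal"
  where "support_fun C z = (SUP x\<in>C. ereal (inner z x))"

text \<open>
  At a point where a convex function is finite, its difference quotient is nondecreasing in the
  step length, so this one-sided limit exists in the extended reals; it may be infinite.
\<close>

definition dir_deriv :: "('a::euclidean_space \<Rightarrow> ereal) \<Rightarrow> 'a \<Rightarrow> 'a \<Rightarrow> ereal"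
  where "dir_deriv f z u = Lim (at_right 0) (\<lambda>t. (f (z + t *\<^sub>R u) - f z) / ereal t)"


section \<open>The primal problem, its multipliers, and the two conditions\<close>

definition primal_obj :: "('p::finite symmat \<Rightarrow> 'p symmat) \<Rightarrow> 'p symmat \<Rightarrow> 'p symmat \<Rightarrow> real"
  where "primal_obj Q c x = 1/2 * inner x (Q x) + inner c x"

definition primal_feasible ::
    "('p::finite symmat \<Rightarrow> real ^ 'm) \<Rightarrow> real ^ 'm \<Rightarrow> 'p symmat set \<Rightarrow> ('p symmat \<times> 'p symmat) set"
  where "primal_feasible A b P =
    {(x, u). A x = b \<and> x - u = 0 \<and> x \<in> psd_cone \<and> u \<in> P}"

definition primal_optimal ::
    "('p::finite symmat \<Rightarrow> 'p symmat) \<Rightarrow> 'p symmat \<Rightarrow> ('p symmat \<Rightarrow> real ^ 'm) \<Rightarrow> real ^ 'm \<Rightarrow>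
     'p symmat set \<Rightarrow> 'p symmat \<Rightarrow> 'p symmat \<Rightarrow> bool"
  where "primal_optimal Q c A b P x u \<longleftrightarrow>
    (x, u) \<in> primal_feasible A b P \<and>
    (\<forall>(x', u') \<in> primal_feasible A b P. primal_obj Q c x \<le> primal_obj Q c x')"

definition multipliers ::
    "('p::finite symmat \<Rightarrow> 'p symmat) \<Rightarrow> 'p symmat \<Rightarrow> ('p symmat \<Rightarrow> real ^ 'm) \<Rightarrow> real ^ 'm \<Rightarrow>
     'p symmat set \<Rightarrow> 'p symmat \<Rightarrow> 'p symmat \<Rightarrow>
     ('p symmat \<times> (real ^ 'm) \<times> 'p symmat \<times> 'p symmat) set"
  where "multipliers Q c A b P x u =
    {(s, y, z, v).
       Q x + c - adjoint A y - z - s = 0 \<and> z + v = 0 \<and>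
       b - A x = 0 \<and> u - x = 0 \<and>
       s \<in> normal_cone nsd_cone (- x) \<and> v \<in> normal_cone P u}"

definition critical_cone ::
    "('p::finite symmat \<Rightarrow> 'p symmat) \<Rightarrow> 'p symmat \<Rightarrow> ('p symmat \<Rightarrow> real ^ 'm) \<Rightarrow>
     'p symmat set \<Rightarrow> 'p symmat \<Rightarrow> 'p symmat \<Rightarrow> ('p symmat \<times> 'p symmat) set"
  where "critical_cone Q c A P x u =
    {(dx, du).
       A dx = 0 \<and> du - dx = 0 \<and>
       dx \<in> tangent_cone psd_cone x \<and> du \<in> tangent_cone P u \<and>
       inner (Q x + c) dx = 0}"

text \<open>
  The trace in the second-order term is the trace inner product of \<open>s\<close> with the product
  \<open>dx x\<^sup>\<dagger> dx\<close>, which is formed in the space of all square matrices.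
\<close>

definition primal_sosc ::
    "('p::finite symmat \<Rightarrow> 'p symmat) \<Rightarrow> 'p symmat \<Rightarrow> ('p symmat \<Rightarrow> real ^ 'm) \<Rightarrow>
     'p symmat set \<Rightarrow> 'p symmat \<Rightarrow> 'p symmat \<Rightarrow> 'p symmat \<Rightarrow> bool"
  where "primal_sosc Q c A P x u s \<longleftrightarrow>
    (\<forall>(dx, du) \<in> critical_cone Q c A P x u. (dx, du) \<noteq> (0, 0) \<longrightarrow>
       inner (Q dx) dx +
       2 * trace (mat_of s ** (mat_of dx ** pseudo_inverse (mat_of x) ** mat_of dx)) > 0)"

definition theta :: "('p::finite) symmat set \<Rightarrow> 'p symmat \<Rightarrow> ereal"
  where "theta P z = support_fun P (- z)"

definition S_set :: "('p::finite) symmat set \<Rightarrow> 'p symmat \<Rightarrow> 'p symmat \<Rightarrow> 'p symmat set"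
  where "S_set P x z = {u. ereal (inner u x) + dir_deriv (theta P) z u = 0}"

text \<open>The Minkowski sum is spelled out because \<open>-\<close> on sets denotes set difference.\<close>

definition dual_srcq ::
    "('p::finite symmat \<Rightarrow> 'p symmat) \<Rightarrow> ('p symmat \<Rightarrow> real ^ 'm) \<Rightarrow> 'p symmat set \<Rightarrow>
     'p symmat set \<Rightarrow> 'p symmat \<Rightarrow> 'p symmat \<Rightarrow> 'p symmat \<Rightarrow> bool"
  where "dual_srcq Q A P W x s z \<longleftrightarrow>
    {h + u + adjoint A y - Q w | h u y w.
       h \<in> tangent_cone psd_cone s \<inter> orth_compl x \<and> u \<in> S_set P x z \<and> w \<in> W} = UNIV"

end

theory Submission
  imports Defs
begin

text \<open>
  Both conditions say that one and the same convex cone \<open>D\<close> of directions is trivial.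

  The left-hand side of the constraint qualification is a convex cone, so by separation it is the
  whole space iff its dual cone is \<open>{0}\<close>. The dual of a sum is the intersection of the duals of
  the summands. The summands \<open>A\<^sup>* \<real>\<^sup>m\<close> and \<open>Q W\<close> contribute \<open>A d = 0\<close> and \<open>Q d = 0\<close>, the latter
  because \<open>Q d\<close> is itself in \<open>W\<close>. For polyhedral \<open>P\<close> the set \<open>S_set P x z\<close> with \<open>z = - v\<close> is the
  negative of the normal cone at \<open>x\<close> of the face of \<open>P\<close> exposed by \<open>v\<close> (\<open>S_set_eq\<close>), and its dual is
  the set of tangent directions of \<open>P\<close> orthogonal to \<open>v\<close> (\<open>dual_of_S_set\<close>). The essential step is
  the semidefinite summand (\<open>dual_of_tangent_cone_inter_orth_compl\<close>). Diagonalise the commuting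
  pair \<open>x\<close>, \<open>s\<close> and split the indices into \<open>\<alpha>\<close> (range of \<open>x\<close>), \<open>\<gamma>\<close> (range of \<open>s\<close>) and the remaining
  \<open>\<beta>\<close>. A tangent direction \<open>h\<close> at \<open>s\<close> orthogonal to \<open>x\<close> has \<open>h\<^bsub>\<alpha>\<alpha>\<^esub> = 0\<close>, \<open>h\<^bsub>\<alpha>\<beta>\<^esub> = 0\<close>,
  \<open>h\<^bsub>\<beta>\<beta>\<^esub>\<close> positive semidefinite and its other blocks free, so the dual consists of the \<open>d\<close> with
  \<open>d\<^bsub>\<beta>\<beta>\<^esub>\<close> positive semidefinite and all blocks in the row \<open>\<gamma>\<close> zero. The tangent directions \<open>d\<close> at
  \<open>x\<close> orthogonal to \<open>s\<close> are described in the same way, except that \<open>d\<^bsub>\<alpha>\<gamma>\<^esub>\<close> is free; and the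
  curvature term \<open>\<langle>s, d x\<^sup>\<dagger> d\<rangle>\<close> is a weighted sum of squares of the entries of \<open>d\<^bsub>\<alpha>\<gamma>\<^esub>\<close>. Hence the dual is
  the zero set of the curvature term on those directions.

  On the primal side both terms of the second-order form are nonnegative, so the second-order
  condition fails exactly if some nonzero critical direction \<open>d\<close> has zero curvature term and
  \<open>Q d = 0\<close>. Since the gradient of the objective is \<open>A\<^sup>* y - v + s\<close>, the critical directions are the
  directions with \<open>A d = 0\<close> that are tangent to both sets and orthogonal to \<open>s\<close> and \<open>v\<close>
  (\<open>critical_cone_iff\<close>). Together this is again the cone \<open>D\<close>.

  The block argument is carried out without diagonalisation: the projections
  \<open>1 - x x\<^sup>\<dagger>\<close> and \<open>1 - s s\<^sup>\<dagger>\<close> onto the kernels take the place of the index sets.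
\<close>

section \<open>Positive semidefinite forms and matrices\<close>

lemma psd_form_Cauchy_Schwarz:
  fixes f :: "'a::real_inner \<Rightarrow> 'a"
  assumes lin: "linear f"
    and sym: "\<And>a b. inner (f a) b = inner a (f b)"
    and pos: "\<And>a. 0 \<le> inner a (f a)"
  shows "(inner a (f b))\<^sup>2 \<le> inner a (f a) * inner b (f b)"
proof -
  interpret linear f by (fact lin)
  have ba: "inner b (f a) = inner a (f b)"
    using sym[of b a] by (simp add: inner_commute)
  have expand: "inner (r *\<^sub>R a + t *\<^sub>R b) (f (r *\<^sub>R a + t *\<^sub>R b))
      = r\<^sup>2 * inner a (f a) + 2 * (r * t) * inner a (f b) + t\<^sup>2 * inner b (f b)" for r t
    by (simp add: add scale inner_add_left inner_add_right ba power2_eq_square algebra_simps)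
  show ?thesis
  proof (cases "inner b (f b) = 0")
    case True
    \<comment> \<open>Along \<open>a + t b\<close> the form is affine in \<open>t\<close>, and a nonnegative affine function is constant.\<close>
    have "inner a (f b) = 0"
    proof (rule ccontr)
      assume ne: "inner a (f b) \<noteq> 0"
      define t where "t = - (inner a (f a) + 1) / (2 * inner a (f b))"
      have "0 \<le> inner a (f a) + 2 * t * inner a (f b)"
        using pos[of "1 *\<^sub>R a + t *\<^sub>R b"] unfolding expand True by simp
      also have "\<dots> = -1"
        using ne by (simp add: t_def field_simps)
      finally show False by simp
    qed
    then show ?thesis using True by simp
  next
    case False
    then have C: "0 < inner b (f b)" using pos[of b] by simp
    have "0 \<le> inner b (f b) * (inner a (f a) * inner b (f b) - (inner a (f b))\<^sup>2)"
      using pos[of "inner b (f b) *\<^sub>R a + (- inner a (f b)) *\<^sub>R b"] unfolding expand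
      by (simp add: power2_eq_square algebra_simps)
    then show ?thesis using C by (simp add: zero_le_mult_iff)
  qed
qed

lemma psd_form_eq_0:
  fixes f :: "'a::real_inner \<Rightarrow> 'a"
  assumes "linear f" "\<And>a b. inner (f a) b = inner a (f b)" "\<And>a. 0 \<le> inner a (f a)"
    and "inner b (f b) = 0"
  shows "f b = 0"
  using psd_form_Cauchy_Schwarz[OF assms(1,2,3), of "f b" b] assms(4) by simp

definition psd_matrix :: "real ^ 'n ^ 'n \<Rightarrow> bool"
  where "psd_matrix M \<longleftrightarrow> transpose M = M \<and> (\<forall>v. 0 \<le> inner v (M *v v))"

definition rank_one :: "real ^ 'n \<Rightarrow> real ^ 'n ^ 'n"
  where "rank_one w = (\<chi> i j. w $ i * w $ j)"

lemma psd_cone_iff: "X \<in> psd_cone \<longleftrightarrow> psd_matrix (mat_of X)"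
  by (simp add: psd_cone_def psd_matrix_def)

lemma mat_of_Sym: "transpose M = M \<Longrightarrow> mat_of (Sym M) = M"
  by (simp add: Sym_inverse)

lemma symmetric_inner: "transpose M = M \<Longrightarrow> inner (M *v a) b = inner a (M *v b)"
  for M :: "real ^ 'n ^ 'n"
  by (metis dot_lmul_matrix transpose_matrix_vector)

lemma matrix_diff_rdistrib: "(A - B) ** C = A ** C - B ** C" for A :: "real ^ 'n ^ 'm"
  by (simp add: matrix_matrix_mult_def vec_eq_iff sum_subtractf left_diff_distrib)

lemma matrix_diff_ldistrib: "A ** (B - C) = A ** B - A ** C" for A :: "real ^ 'n ^ 'm"
  by (simp add: matrix_matrix_mult_def vec_eq_iff sum_subtractf right_diff_distrib)

lemma matrix_add_rdistrib: "(A + B) ** C = A ** C + B ** C" for A :: "real ^ 'n ^ 'm"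
  by (simp add: matrix_matrix_mult_def vec_eq_iff sum.distrib distrib_right)

lemma transpose_add: "transpose (A + B) = transpose A + transpose B" for A :: "real ^ 'n ^ 'm"
  by (simp add: transpose_def vec_eq_iff)

lemma transpose_diff: "transpose (A - B) = transpose A - transpose B" for A :: "real ^ 'n ^ 'm"
  by (simp add: transpose_def vec_eq_iff)

lemma transpose_zero [simp]: "transpose (0 :: real ^ 'n ^ 'm) = 0"
  by (simp add: transpose_def vec_eq_iff)

lemma matrix_mult_zero [simp]:
  "A ** (0 :: real ^ 'k ^ 'n) = 0" "(0 :: real ^ 'm ^ 'k) ** B = 0"
  by (simp_all add: matrix_matrix_mult_def vec_eq_iff)

lemma trace_zero [simp]: "trace (0 :: real ^ 'n ^ 'n) = 0"
  by (simp add: trace_def)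

lemma transpose_rank_one [simp]: "transpose (rank_one w) = rank_one w"
  by (simp add: transpose_def rank_one_def vec_eq_iff)

lemma rank_one_mult: "rank_one w *v a = inner w a *\<^sub>R w"
  by (simp add: rank_one_def matrix_vector_mult_def inner_vec_def vec_eq_iff
      sum_distrib_right sum_distrib_left ac_simps)

lemma mult_rank_one_eq_0: "M *v w = 0 \<Longrightarrow> M ** rank_one w = 0"
  by (simp add: matrix_eq flip: matrix_vector_mul_assoc)
     (simp add: rank_one_mult matrix_vector_mult_scaleR)

lemma trace_mult_rank_one: "trace (M ** rank_one w) = inner w (M *v w)"
  by (simp add: trace_def rank_one_def matrix_matrix_mult_def matrix_vector_mult_def
      inner_vec_def sum_distrib_left ac_simps)

lemma psd_rank_one: "psd_matrix (rank_one w)"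
  by (simp add: psd_matrix_def rank_one_mult inner_commute)

lemma psd_matrix_Cauchy_Schwarz:
  "psd_matrix M \<Longrightarrow> (inner a (M *v b))\<^sup>2 \<le> inner a (M *v a) * inner b (M *v b)"
  by (rule psd_form_Cauchy_Schwarz) (auto simp: psd_matrix_def symmetric_inner)

lemma psd_matrix_kernel: "psd_matrix M \<Longrightarrow> inner b (M *v b) = 0 \<Longrightarrow> M *v b = 0"
  by (rule psd_form_eq_0) (auto simp: psd_matrix_def symmetric_inner)

lemma psd_congruence: "psd_matrix M \<Longrightarrow> psd_matrix (transpose C ** M ** C)"
  unfolding psd_matrix_def
  by (metis (no_types, lifting) dot_lmul_matrix matrix_mul_assoc matrix_transpose_mul
      matrix_vector_mul_assoc transpose_transpose vector_transpose_matrix transpose_matrix_vector)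

text \<open>
  Gaussian elimination: subtracting the multiple of \<open>rank_one (M e\<^sub>i)\<close> that annihilates a nonzero
  diagonal entry keeps \<open>M\<close> positive semidefinite by Cauchy--Schwarz, and a diagonal entry that
  is already zero stays zero because its whole row vanishes. This replaces the spectral theorem.
\<close>

lemma psd_matrix_sum_rank_one:
  fixes M :: "real ^ 'n ^ 'n"
  assumes "psd_matrix M"
  shows "\<exists>ws. M = (\<Sum>w\<leftarrow>ws. rank_one w)"
  using assms
proof (induction "card {i. M $ i $ i \<noteq> 0}" arbitrary: M rule: less_induct)
  case less
  have entry: "inner (axis i 1) (N *v axis j 1) = N $ i $ j" for N :: "real ^ 'n ^ 'n" and i j
    by (simp add: inner_axis' matrix_vector_mul_component inner_axis)
  show ?case
  proof (cases "\<exists>i. M $ i $ i \<noteq> 0")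
    case False
    then have "M *v axis j 1 = 0" for j
      using psd_matrix_kernel[OF less.prems, of "axis j 1"] by (simp add: entry)
    then have "M = 0"
      by (metis entry inner_zero_right vec_eq_iff zero_index)
    then have "M = (\<Sum>w\<leftarrow>[]. rank_one w)" by simp
    then show ?thesis by blast
  next
    case True
    then obtain i where i: "M $ i $ i \<noteq> 0" by blast
    have mpos: "0 < M $ i $ i"
      using i less.prems entry[of i M i] unfolding psd_matrix_def by (metis order_less_le)
    define r where "r = (1 / sqrt (M $ i $ i)) *\<^sub>R (M *v axis i 1)"
    define N where "N = M - rank_one r"
    have rj: "r $ j = M $ j $ i / sqrt (M $ i $ i)" for j
      using entry[of j M i] by (simp add: r_def inner_axis')
    have symM: "M $ j $ k = M $ k $ j" for j k
      using less.prems unfolding psd_matrix_def transpose_def by (metis vec_lambda_beta)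
    have psdN: "psd_matrix N"
      unfolding psd_matrix_def
    proof (intro conjI allI)
      show "transpose N = N"
        using less.prems by (simp add: N_def transpose_diff psd_matrix_def)
      fix v
      have "(inner r v)\<^sup>2 = (inner v (M *v axis i 1))\<^sup>2 / M $ i $ i"
        using mpos by (simp add: r_def power_divide inner_commute)
      also have "\<dots> \<le> inner v (M *v v)"
        using psd_matrix_Cauchy_Schwarz[OF less.prems, of v "axis i 1"] mpos
        by (simp add: entry divide_le_eq)
      finally show "0 \<le> inner v (N *v v)"
        by (simp add: N_def matrix_vector_mult_diff_rdistrib rank_one_mult inner_diff_right
            power2_eq_square inner_commute)
    qed
    have Njj: "N $ j $ j = M $ j $ j - (M $ j $ i)\<^sup>2 / M $ i $ i" for j
      using mpos by (simp add: N_def rank_one_def rj power2_eq_square)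
    have "M $ j $ i = 0" if "M $ j $ j = 0" for j
      using psd_matrix_Cauchy_Schwarz[OF less.prems, of "axis j 1" "axis i 1"] that
      by (simp add: entry)
    then have "{j. N $ j $ j \<noteq> 0} \<subseteq> {j. M $ j $ j \<noteq> 0}"
      by (auto simp: Njj)
    moreover have "i \<notin> {j. N $ j $ j \<noteq> 0}"
      using i by (simp add: Njj power2_eq_square)
    ultimately have "{j. N $ j $ j \<noteq> 0} \<subset> {j. M $ j $ j \<noteq> 0}"
      using i by blast
    then have "card {j. N $ j $ j \<noteq> 0} < card {j. M $ j $ j \<noteq> 0}"
      by (intro psubset_card_mono) auto
    then obtain ws where "N = (\<Sum>w\<leftarrow>ws. rank_one w)"
      using less.hyps psdN by blast
    then have "M = (\<Sum>w\<leftarrow>r # ws. rank_one w)"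
      by (simp add: N_def algebra_simps)
    then show ?thesis by blast
  qed
qed

lemma trace_mult_sum_list:
  "trace (M ** (\<Sum>w\<leftarrow>ws. rank_one w)) = (\<Sum>w\<leftarrow>ws. inner w (M *v w))"
  by (induction ws) (simp_all add: matrix_add_ldistrib trace_add trace_mult_rank_one)

text \<open>
  The next two lemmas are self-duality and complementarity for the semidefinite cone. Writing
  \<open>N\<close> as a sum of \<open>rank_one w\<close> turns \<open>trace (M ** N)\<close> into a sum of the nonnegative numbers
  \<open>inner w (M *v w)\<close>; if it vanishes, \<open>M\<close> annihilates every \<open>w\<close>.
\<close>

lemma psd_trace_mult_nonneg:
  assumes "psd_matrix M" "psd_matrix N"
  shows "0 \<le> trace (M ** N)"
proof -
  obtain ws where "N = (\<Sum>w\<leftarrow>ws. rank_one w)"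
    using psd_matrix_sum_rank_one[OF assms(2)] by blast
  then show ?thesis
    using assms(1) by (auto simp: trace_mult_sum_list psd_matrix_def intro!: sum_list_nonneg)
qed

lemma psd_trace_mult_eq_0:
  assumes "psd_matrix M" "psd_matrix N" "trace (M ** N) = 0"
  shows "M ** N = 0" "N ** M = 0"
proof -
  obtain ws where N: "N = (\<Sum>w\<leftarrow>ws. rank_one w)"
    using psd_matrix_sum_rank_one[OF assms(2)] by blast
  have "\<forall>w\<in>set ws. inner w (M *v w) = 0"
    using assms(1,3) unfolding N trace_mult_sum_list
    by (subst (asm) sum_list_nonneg_eq_0_iff) (auto simp: psd_matrix_def)
  then have "\<forall>w\<in>set ws. M ** rank_one w = 0"
    using psd_matrix_kernel[OF assms(1)] mult_rank_one_eq_0 by blast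
  then show MN: "M ** N = 0"
    unfolding N by (induction ws) (simp_all add: matrix_add_ldistrib)
  show "N ** M = 0"
    using arg_cong[OF MN, of transpose] assms(1,2)
    by (simp add: matrix_transpose_mul psd_matrix_def)
qed


section \<open>The pseudo-inverse of a symmetric matrix\<close>

lemma is_pseudo_inverse_unique:
  fixes M :: "real ^ 'n ^ 'm"
  assumes X: "is_pseudo_inverse M X" and Y: "is_pseudo_inverse M Y"
  shows "X = Y"
proof -
  \<comment> \<open>The symmetry conditions make \<open>M X\<close> and \<open>M Y\<close>, and likewise \<open>X M\<close> and \<open>Y M\<close>, equal.\<close>
  have "M ** X = transpose (M ** X)" using X by (simp add: is_pseudo_inverse_def)
  also have "\<dots> = transpose (M ** Y ** (M ** X))"
    using Y by (simp add: is_pseudo_inverse_def matrix_mul_assoc)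
  also have "\<dots> = M ** X ** (M ** Y)"
    using X Y unfolding matrix_transpose_mul[of "M ** Y"] by (simp add: is_pseudo_inverse_def)
  also have "\<dots> = M ** Y" using X by (simp add: is_pseudo_inverse_def matrix_mul_assoc)
  finally have MX: "M ** X = M ** Y" .
  have "X ** M = transpose (X ** M)" using X by (simp add: is_pseudo_inverse_def)
  also have "\<dots> = transpose (X ** M ** (Y ** M))"
    using Y by (simp add: is_pseudo_inverse_def flip: matrix_mul_assoc)
  also have "\<dots> = Y ** M ** (X ** M)"
    using X Y unfolding matrix_transpose_mul[of "X ** M"] by (simp add: is_pseudo_inverse_def)
  also have "\<dots> = Y ** M" using X by (simp add: is_pseudo_inverse_def flip: matrix_mul_assoc)
  finally have XM: "X ** M = Y ** M" .
  have "X = X ** M ** X" using X by (simp add: is_pseudo_inverse_def)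
  also have "\<dots> = Y ** (M ** X)" by (simp add: XM matrix_mul_assoc)
  also have "\<dots> = Y" using Y by (simp add: MX is_pseudo_inverse_def matrix_mul_assoc)
  finally show ?thesis .
qed

lemma orthogonal_projection_onto_kernel:
  fixes M :: "real ^ 'n ^ 'n"
  obtains E where "transpose E = E" "M ** E = 0" "\<And>v. M *v v = 0 \<Longrightarrow> E *v v = v"
proof -
  have sub: "subspace {v. M *v v = 0}"
    by (auto simp: subspace_def matrix_vector_right_distrib matrix_vector_mult_scaleR)
  obtain B where B: "B \<subseteq> {v. M *v v = 0}" "pairwise orthogonal B" "\<And>w. w \<in> B \<Longrightarrow> norm w = 1"
    "independent B" "card B = dim {v. M *v v = 0}" "span B = {v. M *v v = 0}"
    by (rule orthonormal_basis_subspace[OF sub]) (rule that)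
  have fin: "finite B" by (rule independent_imp_finite[OF B(4)])
  define E where "E = (\<Sum>w\<in>B. rank_one w)"
  have sum_mult: "(\<Sum>w\<in>D. rank_one w) *v v = (\<Sum>w\<in>D. inner w v *\<^sub>R w)" for D and v :: "real ^ 'n"
    by (induction D rule: infinite_finite_induct)
       (simp_all add: matrix_vector_mult_add_rdistrib rank_one_mult)
  have "transpose (\<Sum>w\<in>D. rank_one w) = (\<Sum>w\<in>D. rank_one w)" for D :: "(real ^ 'n) set"
    by (induction D rule: infinite_finite_induct)
       (simp_all add: transpose_add)
  then have sym: "transpose E = E" by (simp add: E_def)
  have "M ** (\<Sum>w\<in>D. rank_one w) = 0" if "D \<subseteq> B" for D
    using that
    by (induction D rule: infinite_finite_induct)
       (use B(1) in \<open>auto simp: matrix_add_ldistrib mult_rank_one_eq_0\<close>)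
  then have ME: "M ** E = 0" by (simp add: E_def)
  have basis: "E *v v = v" if "v \<in> B" for v
  proof -
    have "inner w v *\<^sub>R w = (if w = v then v else 0)" if "w \<in> B" for w
      using B(2,3) that \<open>v \<in> B\<close> by (auto simp: pairwise_def orthogonal_def norm_eq_1)
    then have "(\<Sum>w\<in>B. inner w v *\<^sub>R w) = (\<Sum>w\<in>B. if w = v then v else 0)"
      by (rule sum.cong[OF refl])
    also have "\<dots> = v" using fin that by simp
    finally show ?thesis by (simp add: E_def sum_mult)
  qed
  have "E *v v = v" if "M *v v = 0" for v
  proof -
    have "v \<in> span B" using that B(6) by simp
    then show ?thesis
      by (induction rule: span_induct_alt)
         (simp_all add: matrix_vector_right_distrib matrix_vector_mult_scaleR basis)
  qed
  then show thesis using that sym ME by blast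
qed

text \<open>
  With \<open>E\<close> the orthogonal projection onto the kernel of \<open>M\<close>, the matrix \<open>M + E\<close> is invertible and
  \<open>(M + E)\<^sup>-\<^sup>1 - E\<close> inverts \<open>M\<close> on its range and vanishes on its kernel.
\<close>

lemma symmetric_pseudo_inverse_exists:
  fixes M :: "real ^ 'n ^ 'n"
  assumes sym: "transpose M = M"
  shows "\<exists>X. is_pseudo_inverse M X"
proof -
  obtain E where E: "transpose E = E" "M ** E = 0" "\<And>v. M *v v = 0 \<Longrightarrow> E *v v = v"
    by (rule orthogonal_projection_onto_kernel[of M]) (rule that)
  have EM: "E ** M = 0"
    using arg_cong[OF E(2), of transpose] E(1) sym
    by (simp add: matrix_transpose_mul)
  have EE: "E ** E = E"
  proof -
    have "M *v (E *v v) = 0" for v by (simp add: matrix_vector_mul_assoc E(2))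
    then show ?thesis by (simp add: matrix_eq E(3) flip: matrix_vector_mul_assoc)
  qed
  have "v = 0" if "(M + E) *v v = 0" for v
  proof -
    have eq: "M *v v + E *v v = 0" using that by (simp add: matrix_vector_mult_add_rdistrib)
    have "E *v v = (E ** M) *v v + (E ** E) *v v" by (simp add: EM EE)
    also have "\<dots> = E *v (M *v v + E *v v)"
      by (simp add: matrix_vector_right_distrib matrix_vector_mul_assoc)
    also have "\<dots> = 0" by (simp add: eq)
    finally have Ev: "E *v v = 0" .
    then have "M *v v = 0" using eq by simp
    then show "v = 0" using E(3) Ev by force
  qed
  then obtain R where R: "R ** (M + E) = mat 1" "(M + E) ** R = mat 1"
    by (metis matrix_left_invertible_ker matrix_left_right_inverse)
  have "R ** E = R ** ((M + E) ** E)" by (simp add: matrix_add_rdistrib E(2) EE)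
  then have RE: "R ** E = E" by (simp add: matrix_mul_assoc R(1))
  have "E ** R = (E ** (M + E)) ** R" by (simp add: matrix_add_ldistrib EM EE)
  then have ER: "E ** R = E" by (simp add: R(2) flip: matrix_mul_assoc)
  have RM: "R ** M = mat 1 - E"
    using R(1) RE by (simp add: matrix_add_ldistrib algebra_simps)
  have MR: "M ** R = mat 1 - E"
    using R(2) ER by (simp add: matrix_add_rdistrib algebra_simps)
  have MX: "M ** (R - E) = mat 1 - E"
    by (simp add: matrix_diff_ldistrib MR E(2))
  have XM: "(R - E) ** M = mat 1 - E"
    by (simp add: matrix_diff_rdistrib RM EM)
  have "is_pseudo_inverse M (R - E)"
    unfolding is_pseudo_inverse_def MX XM
    by (simp add: matrix_diff_rdistrib matrix_diff_ldistrib EM E(1) EE ER transpose_diff)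
  then show ?thesis by blast
qed

lemma pseudo_inverse_symmetric:
  fixes M :: "real ^ 'n ^ 'n"
  assumes sym: "transpose M = M"
  shows "is_pseudo_inverse M (pseudo_inverse M)"
    and "transpose (pseudo_inverse M) = pseudo_inverse M"
    and "M ** pseudo_inverse M = pseudo_inverse M ** M"
proof -
  show pinv: "is_pseudo_inverse M (pseudo_inverse M)"
    unfolding pseudo_inverse_def
    by (metis symmetric_pseudo_inverse_exists[OF sym] is_pseudo_inverse_unique theI)
  have "is_pseudo_inverse M (transpose (pseudo_inverse M))"
    using pinv sym unfolding is_pseudo_inverse_def
    by (metis matrix_mul_assoc matrix_transpose_mul)
  then show sp: "transpose (pseudo_inverse M) = pseudo_inverse M"
    using pinv is_pseudo_inverse_unique by blast
  show "M ** pseudo_inverse M = pseudo_inverse M ** M"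
    using pinv sym sp unfolding is_pseudo_inverse_def by (metis matrix_transpose_mul)
qed

lemma psd_pseudo_inverse:
  assumes "psd_matrix M"
  shows "psd_matrix (pseudo_inverse M)"
  using psd_congruence[OF assms, of "pseudo_inverse M"] pseudo_inverse_symmetric[of M] assms
  by (simp add: psd_matrix_def is_pseudo_inverse_def)


section \<open>Polarity of cones\<close>

lemma tangent_cone_eq_cone_hull:
  "x \<in> C \<Longrightarrow> tangent_cone C x = closure (cone hull ((\<lambda>y. y - x) ` C))"
  by (auto simp: tangent_cone_def cone_hull_expl intro!: arg_cong[of _ _ closure])

lemma tangent_cone_halfspace:
  assumes "d \<in> tangent_cone C x" "\<And>y. y \<in> C \<Longrightarrow> inner n (y - x) \<le> 0"
  shows "inner n d \<le> 0"
proof -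
  have "{t *\<^sub>R (y - x) | t y. 0 \<le> t \<and> y \<in> C} \<subseteq> {d. inner n d \<le> 0}"
    using assms(2) by (auto simp: mult_nonneg_nonpos)
  then have "closure {t *\<^sub>R (y - x) | t y. 0 \<le> t \<and> y \<in> C} \<subseteq> {d. inner n d \<le> 0}"
    by (intro closure_minimal closed_halfspace_le)
  then show ?thesis using assms(1) by (auto simp: tangent_cone_def split: if_splits)
qed

text \<open>The bipolar theorem for the cone of feasible directions.\<close>

lemma tangent_cone_polar:
  assumes "convex C" "x \<in> C"
  shows "d \<in> tangent_cone C x \<longleftrightarrow> (\<forall>n\<in>normal_cone C x. inner n d \<le> 0)"
proof
  assume "d \<in> tangent_cone C x"
  then show "\<forall>n\<in>normal_cone C x. inner n d \<le> 0"
    using assms(2) by (auto simp: normal_cone_def intro: tangent_cone_halfspace)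
next
  assume d: "\<forall>n\<in>normal_cone C x. inner n d \<le> 0"
  let ?K = "cone hull ((\<lambda>y. y - x) ` C)"
  have gen: "t *\<^sub>R (y - x) \<in> ?K" if "0 \<le> t" "y \<in> C" for t y
    using that by (auto simp: cone_hull_expl)
  show "d \<in> tangent_cone C x"
  proof (rule ccontr)
    assume "d \<notin> tangent_cone C x"
    then have "d \<notin> closure ?K" using assms(2) by (simp add: tangent_cone_eq_cone_hull)
    moreover have "convex (closure ?K)"
      using assms(1) by (intro convex_closure convex_cone_hull) (simp add: convex_translation_subtract)
    ultimately obtain a r where a: "inner a d < r" "\<forall>k\<in>closure ?K. r < inner a k"
      using separating_hyperplane_closed_point[of "closure ?K" d] by auto
    have K: "r < t * inner a (y - x)" if "0 \<le> t" "y \<in> C" for t y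
      using a(2) gen[OF that] closure_subset by fastforce
    have r: "r < 0" using K[of 0 x] assms(2) by simp
    have "0 \<le> inner a (y - x)" if "y \<in> C" for y
    proof (rule ccontr)
      assume neg: "\<not> 0 \<le> inner a (y - x)"
      then have "r < (r / inner a (y - x)) * inner a (y - x)"
        using r that by (intro K) (auto simp: divide_nonpos_neg)
      then show False using neg by simp
    qed
    then have "- a \<in> normal_cone C x" using assms(2) by (simp add: normal_cone_def)
    then show False using d a(1) r by force
  qed
qed

text \<open>
  A point outside a convex cone is separated from it by a hyperplane, and scaling moves that
  hyperplane through the origin.
\<close>

lemma convex_cone_eq_UNIV_iff:
  fixes K :: "'a::euclidean_space set"
  assumes zero: "0 \<in> K" and add: "\<And>a b. a \<in> K \<Longrightarrow> b \<in> K \<Longrightarrow> a + b \<in> K"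
    and scale: "\<And>t a. 0 \<le> t \<Longrightarrow> a \<in> K \<Longrightarrow> t *\<^sub>R a \<in> K"
  shows "K = UNIV \<longleftrightarrow> (\<forall>d. (\<forall>k\<in>K. 0 \<le> inner d k) \<longrightarrow> d = 0)"
proof
  assume "K = UNIV"
  then show "\<forall>d. (\<forall>k\<in>K. 0 \<le> inner d k) \<longrightarrow> d = 0"
    by (metis UNIV_I inner_eq_zero_iff inner_ge_zero inner_minus_right neg_0_le_iff_le order_antisym)
next
  assume dual: "\<forall>d. (\<forall>k\<in>K. 0 \<le> inner d k) \<longrightarrow> d = 0"
  show "K = UNIV"
  proof (rule ccontr)
    assume "K \<noteq> UNIV"
    then obtain p where p: "p \<notin> K" by blast
    have "convex K" by (auto simp: convex_def intro: add scale)
    then obtain a r where a: "a \<noteq> 0" "\<forall>k\<in>K. inner a k \<le> r"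
      using separating_hyperplane_sets[of K "{p}"] zero p by auto
    have r: "0 \<le> r" using a(2) zero by fastforce
    have "inner a k \<le> 0" if "k \<in> K" for k
    proof (rule ccontr)
      assume pos: "\<not> inner a k \<le> 0"
      have "((r + 1) / inner a k) *\<^sub>R k \<in> K"
        using pos r by (intro scale[OF _ that]) simp
      then have "inner a (((r + 1) / inner a k) *\<^sub>R k) \<le> r" using a(2) by blast
      then show False using pos by simp
    qed
    then have "- a = 0" using dual by (metis inner_minus_left neg_0_le_iff_le)
    then show False using a(1) by simp
  qed
qed


section \<open>Tangent cones of the semidefinite cone at a complementary pair\<close>

lemma inner_symmat_trace: "inner X Y = trace (mat_of X ** mat_of Y)"
  by (rule inner_symmat_def)

lemma convex_psd_cone: "convex psd_cone"
  by (auto simp: convex_def psd_cone_def matrix_vector_mult_add_rdistrib inner_add_right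
      simp flip: scaleR_matrix_vector_assoc)

lemma psd_cone_zero: "0 \<in> psd_cone"
  by (simp add: psd_cone_def)

lemma psd_cone_add: "a \<in> psd_cone \<Longrightarrow> b \<in> psd_cone \<Longrightarrow> a + b \<in> psd_cone"
  by (simp add: psd_cone_def matrix_vector_mult_add_rdistrib inner_add_right)

lemma psd_cone_inner_nonneg: "a \<in> psd_cone \<Longrightarrow> b \<in> psd_cone \<Longrightarrow> 0 \<le> inner a b"
  by (simp add: inner_symmat_trace psd_cone_iff psd_trace_mult_nonneg)

lemma Sym_rank_one_in_psd_cone: "Sym (rank_one w) \<in> psd_cone"
  by (simp add: psd_cone_iff mat_of_Sym psd_rank_one)

lemma inner_Sym_rank_one: "inner d (Sym (rank_one w)) = inner w (mat_of d *v w)"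
  by (simp add: inner_symmat_trace mat_of_Sym trace_mult_rank_one)

lemma normal_cone_at_cone_point:
  assumes "x \<in> C" and zero: "0 \<in> C" and add: "\<And>a b. a \<in> C \<Longrightarrow> b \<in> C \<Longrightarrow> a + b \<in> C"
  shows "n \<in> normal_cone C x \<longleftrightarrow> inner n x = 0 \<and> (\<forall>y\<in>C. inner n y \<le> 0)"
proof
  assume n: "n \<in> normal_cone C x"
  then have *: "inner n (y - x) \<le> 0" if "y \<in> C" for y
    using that by (simp add: normal_cone_def split: if_splits)
  have "inner n y \<le> 0" if "y \<in> C" for y
    using *[OF add[OF that assms(1)]] by simp
  moreover have "0 \<le> inner n x" using *[OF zero] by simp
  ultimately show "inner n x = 0 \<and> (\<forall>y\<in>C. inner n y \<le> 0)"
    using assms(1) by (meson order_antisym)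
qed (use assms(1) in \<open>simp add: normal_cone_def inner_diff_right\<close>)

lemma psd_cone_self_dual: "(\<forall>y\<in>psd_cone. 0 \<le> inner n y) \<longleftrightarrow> n \<in> psd_cone"
proof
  assume n: "\<forall>y\<in>psd_cone. 0 \<le> inner n y"
  have "0 \<le> inner w (mat_of n *v w)" for w
    using bspec[OF n Sym_rank_one_in_psd_cone[of w]] by (simp add: inner_Sym_rank_one)
  then show "n \<in> psd_cone" by (simp add: psd_cone_def)
qed (simp add: psd_cone_inner_nonneg)

lemma normal_cone_psd_cone:
  assumes "x \<in> psd_cone"
  shows "n \<in> normal_cone psd_cone x \<longleftrightarrow> - n \<in> psd_cone \<and> inner n x = 0"
proof -
  have "- n \<in> psd_cone \<longleftrightarrow> (\<forall>y\<in>psd_cone. inner n y \<le> 0)"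
    using psd_cone_self_dual[of "- n"] by simp
  then show ?thesis
    using normal_cone_at_cone_point[OF assms psd_cone_zero psd_cone_add] by blast
qed

lemma normal_cone_nsd_cone:
  assumes "x \<in> psd_cone"
  shows "s \<in> normal_cone nsd_cone (- x) \<longleftrightarrow> s \<in> psd_cone \<and> inner s x = 0"
proof -
  have "- x \<in> nsd_cone" "0 \<in> nsd_cone" using assms psd_cone_zero by (force simp: nsd_cone_def)+
  moreover have "a + b \<in> nsd_cone" if "a \<in> nsd_cone" "b \<in> nsd_cone" for a b :: "'a symmat"
    using that psd_cone_add unfolding nsd_cone_def by (force simp: image_iff)
  ultimately have "s \<in> normal_cone nsd_cone (- x) \<longleftrightarrow>
      inner s (- x) = 0 \<and> (\<forall>y\<in>nsd_cone. inner s y \<le> 0)"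
    by (rule normal_cone_at_cone_point)
  also have "(\<forall>y\<in>nsd_cone. inner s y \<le> 0) \<longleftrightarrow> s \<in> psd_cone"
    using psd_cone_self_dual[of s] by (simp add: nsd_cone_def)
  finally show ?thesis by auto
qed

lemma tangent_psd_cone_iff:
  assumes "x \<in> psd_cone"
  shows "d \<in> tangent_cone psd_cone x \<longleftrightarrow> (\<forall>n\<in>psd_cone. inner n x = 0 \<longrightarrow> 0 \<le> inner n d)"
proof
  assume d: "d \<in> tangent_cone psd_cone x"
  show "\<forall>n\<in>psd_cone. inner n x = 0 \<longrightarrow> 0 \<le> inner n d"
  proof (intro ballI impI)
    fix n assume "n \<in> psd_cone" "inner n x = 0"
    then have "- n \<in> normal_cone psd_cone x" by (simp add: normal_cone_psd_cone[OF assms])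
    then show "0 \<le> inner n d" using d tangent_cone_polar[OF convex_psd_cone assms] by fastforce
  qed
next
  assume d: "\<forall>n\<in>psd_cone. inner n x = 0 \<longrightarrow> 0 \<le> inner n d"
  have "inner n d \<le> 0" if "n \<in> normal_cone psd_cone x" for n
    using d[rule_format, of "- n"] that by (simp add: normal_cone_psd_cone[OF assms])
  then show "d \<in> tangent_cone psd_cone x"
    by (simp add: tangent_cone_polar[OF convex_psd_cone assms])
qed

lemma complementary_psd_product:
  assumes "x \<in> psd_cone" "s \<in> psd_cone" "inner x s = 0"
  shows "mat_of x ** mat_of s = 0" "mat_of s ** mat_of x = 0"
  using psd_trace_mult_eq_0[of "mat_of x" "mat_of s"] assms
  by (simp_all add: psd_cone_iff inner_symmat_trace)

text \<open>
  A tangent direction at \<open>x\<close> is positive semidefinite on the kernel of \<open>x\<close>, since there the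
  feasible directions \<open>t (y - x)\<close> agree with \<open>t y\<close>.
\<close>

lemma tangent_psd_compression:
  assumes x: "x \<in> psd_cone" and d: "d \<in> tangent_cone psd_cone x"
    and E: "transpose E = E" "mat_of x ** E = 0"
  shows "psd_matrix (E ** mat_of d ** E)"
  unfolding psd_matrix_def
proof (intro conjI allI)
  show "transpose (E ** mat_of d ** E) = E ** mat_of d ** E"
    by (simp add: matrix_transpose_mul E(1) matrix_mul_assoc)
  fix v
  have "mat_of x *v (E *v v) = 0" by (simp add: matrix_vector_mul_assoc E(2))
  then have "inner (Sym (rank_one (E *v v))) x = 0"
    by (simp add: inner_commute[of "Sym _"] inner_Sym_rank_one)
  then have "0 \<le> inner (Sym (rank_one (E *v v))) d"
    using d Sym_rank_one_in_psd_cone unfolding tangent_psd_cone_iff[OF x] by blast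
  also have "\<dots> = inner v (E *v (mat_of d *v (E *v v)))"
    by (simp add: inner_commute[of "Sym _"] inner_Sym_rank_one symmetric_inner[OF E(1)])
  finally show "0 \<le> inner v (E ** mat_of d ** E *v v)"
    by (simp add: matrix_vector_mul_assoc matrix_mul_assoc)
qed

lemma kernel_projection_pseudo_inverse:
  fixes M :: "real ^ 'n ^ 'n"
  assumes "transpose M = M"
  defines "Z \<equiv> mat 1 - M ** pseudo_inverse M"
  shows "transpose Z = Z" "M ** Z = 0" "Z ** M = 0"
    and "\<And>N. M ** N = 0 \<Longrightarrow> Z ** N = N" "\<And>N. N ** M = 0 \<Longrightarrow> N ** Z = N"
proof -
  note p = pseudo_inverse_symmetric[OF assms(1)]
  note pinv = p(1)[unfolded is_pseudo_inverse_def]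
  show "transpose Z = Z" using pinv by (simp add: Z_def transpose_diff)
  show "M ** Z = 0" unfolding Z_def p(3) using pinv
    by (simp add: matrix_diff_ldistrib matrix_mul_assoc)
  show "Z ** M = 0" unfolding Z_def using pinv
    by (simp add: matrix_diff_rdistrib)
  show "Z ** N = N" if "M ** N = 0" for N
    unfolding Z_def p(3) using that
    by (simp add: matrix_diff_rdistrib flip: matrix_mul_assoc)
  show "N ** Z = N" if "N ** M = 0" for N
    unfolding Z_def using that by (simp add: matrix_diff_ldistrib matrix_mul_assoc)
qed

lemma curvature_term_nonneg:
  assumes "x \<in> psd_cone" "s \<in> psd_cone"
  shows "0 \<le> trace (mat_of s ** (mat_of d ** pseudo_inverse (mat_of x) ** mat_of d))"
  using assms psd_congruence[OF psd_pseudo_inverse, of "mat_of x" "mat_of d"]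
  by (simp add: psd_cone_iff psd_trace_mult_nonneg)

text \<open>
  In the block picture: zero curvature gives \<open>d\<^bsub>\<alpha>\<gamma>\<^esub> = 0\<close>, and positive semidefiniteness of \<open>d\<close> on
  the kernel of \<open>x\<close>, that is on \<open>\<beta> \<union> \<gamma>\<close>, together with orthogonality to \<open>s\<close> gives \<open>d\<^bsub>\<beta>\<gamma>\<^esub> = 0\<close> and
  \<open>d\<^bsub>\<gamma>\<gamma>\<^esub> = 0\<close>.
\<close>

lemma annihilates_of_zero_curvature:
  assumes x: "x \<in> psd_cone" and s: "s \<in> psd_cone" and xs: "inner x s = 0"
    and d: "d \<in> tangent_cone psd_cone x" and sd: "inner s d = 0"
    and zero: "trace (mat_of s ** (mat_of d ** pseudo_inverse (mat_of x) ** mat_of d)) = 0"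
  shows "mat_of d ** mat_of s = 0"
proof -
  define X S D where "X = mat_of x" and "S = mat_of s" and "D = mat_of d"
  have sym: "transpose X = X" "transpose D = D" by (simp_all add: X_def D_def)
  have psd: "psd_matrix X" "psd_matrix S" using x s by (simp_all add: X_def S_def psd_cone_iff)
  have XS: "X ** S = 0" and SX: "S ** X = 0"
    using complementary_psd_product[OF x s xs] by (simp_all add: X_def S_def)
  define R where "R = pseudo_inverse X"
  note p = pseudo_inverse_symmetric[OF sym(1), folded R_def]
  define E where "E = mat 1 - X ** R"
  note E = kernel_projection_pseudo_inverse[OF sym(1), folded R_def, folded E_def]
  have "psd_matrix (D ** R ** D)"
    using psd_congruence[OF psd_pseudo_inverse[OF psd(1)], of D] by (simp add: sym R_def)
  then have "S ** (D ** R ** D) = 0"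
    using psd_trace_mult_eq_0(1)[OF psd(2)] zero by (simp add: S_def D_def X_def R_def)
  \<comment> \<open>The congruence \<open>S D R D S\<close> of \<open>R\<close> vanishes, so \<open>R\<close> annihilates the range of \<open>D S\<close>.\<close>
  then have quad: "S ** D ** R ** D ** S = 0" by (simp add: matrix_mul_assoc)
  have "R *v (D *v (S *v a)) = 0" for a
  proof (rule psd_matrix_kernel)
    show "psd_matrix R" unfolding R_def by (rule psd_pseudo_inverse[OF psd(1)])
    have "inner (D *v (S *v a)) (R *v (D *v (S *v a))) = inner a ((S ** D ** R ** D ** S) *v a)"
      using psd(2) sym(2)
      by (simp add: symmetric_inner psd_matrix_def flip: matrix_vector_mul_assoc)
    then show "inner (D *v (S *v a)) (R *v (D *v (S *v a))) = 0" by (simp add: quad)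
  qed
  then have RDS: "R ** (D ** S) = 0"
    by (simp add: matrix_eq flip: matrix_vector_mul_assoc)
  have ES: "E ** S = S" and SE: "S ** E = S" using E(4)[OF XS] E(5)[OF SX] by (simp_all add: E_def)
  have "psd_matrix (E ** D ** E)"
    using tangent_psd_compression[OF x d E(1)] E(2) by (simp add: X_def D_def)
  moreover have "trace (E ** D ** E ** S) = trace (D ** S)"
  proof -
    have "trace (E ** D ** E ** S) = trace (E ** (D ** S))"
      by (simp add: ES flip: matrix_mul_assoc)
    also have "\<dots> = trace (D ** (S ** E))"
      by (subst trace_mul_sym) (simp add: matrix_mul_assoc)
    finally show ?thesis by (simp add: SE)
  qed
  moreover have "trace (D ** S) = 0"
    using sd unfolding inner_commute[of s d] by (simp add: inner_symmat_trace D_def S_def)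
  ultimately have "E ** D ** E ** S = 0"
    using psd_trace_mult_eq_0(1)[OF _ psd(2)] by simp
  then have "E ** (D ** S) = 0" by (simp add: ES flip: matrix_mul_assoc)
  moreover have "E ** (D ** S) = D ** S - X ** (R ** (D ** S))"
    by (simp add: E_def matrix_diff_rdistrib matrix_mul_assoc)
  ultimately show ?thesis using RDS by (simp add: D_def S_def)
qed

text \<open>
  From left to right, three kinds of test directions suffice: positive semidefinite \<open>h\<close>
  orthogonal to \<open>x\<close> for tangency, \<open>\<plusminus> s\<close> for orthogonality, and \<open>\<plusminus>\<close> the symmetrised product
  \<open>s d x\<^sup>\<dagger>\<close> for the curvature term. From right to left, \<open>d s = 0\<close> allows \<open>h\<close> to be replaced by
  its compression to the kernel of \<open>s\<close>.
\<close>

lemma dual_of_tangent_cone_inter_orth_compl: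
  assumes x: "x \<in> psd_cone" and s: "s \<in> psd_cone" and xs: "inner x s = 0"
  shows "(\<forall>h \<in> tangent_cone psd_cone s \<inter> orth_compl x. 0 \<le> inner d h) \<longleftrightarrow>
    d \<in> tangent_cone psd_cone x \<and> inner s d = 0 \<and>
    trace (mat_of s ** (mat_of d ** pseudo_inverse (mat_of x) ** mat_of d)) = 0"
    (is "?dual \<longleftrightarrow> ?tan \<and> ?orth \<and> ?flat")
proof
  assume dual: ?dual
  have mem: "0 \<le> inner d h"
    if "inner h x = 0" "\<And>n. n \<in> psd_cone \<Longrightarrow> inner n s = 0 \<Longrightarrow> 0 \<le> inner n h" for h
    using dual that by (simp add: tangent_psd_cone_iff[OF s] orth_compl_def)
  have lineality: "inner d h = 0"
    if "inner h x = 0" "\<And>n. n \<in> psd_cone \<Longrightarrow> inner n s = 0 \<Longrightarrow> inner n h = 0" for h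
    using mem[of h] mem[of "- h"] that by force
  have ?tan
    unfolding tangent_psd_cone_iff[OF x] using mem
    by (auto simp: inner_commute[of _ d] psd_cone_inner_nonneg)
  moreover have ?orth
    using lineality[of s] xs by (simp add: inner_commute)
  moreover have ?flat
  proof -
    define X S D R where "X = mat_of x" and "S = mat_of s" and "D = mat_of d"
      and "R = pseudo_inverse (mat_of x)"
    note p = pseudo_inverse_symmetric[OF transpose_mat_of[of x], folded R_def X_def]
    have XS: "X ** S = 0" "S ** X = 0"
      using complementary_psd_product[OF x s xs] by (simp_all add: X_def S_def)
    have sym: "transpose X = X" "transpose S = S" "transpose D = D" by (simp_all add: X_def S_def D_def)
    \<comment> \<open>Both \<open>H\<close> and \<open>- H\<close> are tangent at \<open>s\<close>, as every normal there is annihilated by \<open>S\<close>.\<close>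
    define H where "H = S ** D ** R + R ** D ** S"
    have symH: "transpose H = H"
      by (simp add: H_def transpose_add matrix_transpose_mul sym p(2) matrix_mul_assoc add.commute)
    have tr: "trace (N ** H) = 2 * trace (N ** S ** D ** R)" if "transpose N = N" for N
    proof -
      have "trace (N ** (R ** D ** S)) = trace (transpose (N ** (R ** D ** S)))"
        by (simp add: trace_def transpose_def)
      also have "\<dots> = trace (S ** D ** R ** N)"
        by (simp add: matrix_transpose_mul sym p(2) that matrix_mul_assoc)
      also have "\<dots> = trace (N ** S ** D ** R)"
        by (subst trace_mul_sym) (simp add: matrix_mul_assoc)
      finally show ?thesis
        by (simp add: H_def matrix_add_ldistrib trace_add matrix_mul_assoc)
    qed
    have "inner d (Sym H) = 0"
    proof (rule lineality)
      have "inner x (Sym H) = trace (X ** H)"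
        by (simp only: inner_symmat_trace mat_of_Sym symH X_def)
      then have "inner x (Sym H) = 0" using tr[OF sym(1)] by (simp add: XS)
      then show "inner (Sym H) x = 0" by (simp add: inner_commute)
      fix n :: "'a symmat" assume "n \<in> psd_cone" "inner n s = 0"
      then have "mat_of n ** S = 0"
        using complementary_psd_product(1)[of n s] s by (simp add: S_def)
      then show "inner n (Sym H) = 0"
        using tr[OF transpose_mat_of[of n]] by (simp add: inner_symmat_trace mat_of_Sym symH)
    qed
    then have "trace (D ** S ** D ** R) = 0"
      using tr[OF sym(3)] by (simp add: inner_symmat_trace mat_of_Sym symH D_def)
    moreover have "trace (D ** S ** D ** R) = trace (S ** (D ** R ** D))"
      by (subst matrix_mul_assoc[symmetric], subst matrix_mul_assoc[symmetric], subst trace_mul_sym)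
         (simp add: matrix_mul_assoc)
    ultimately show ?thesis by (simp add: X_def S_def D_def R_def)
  qed
  ultimately show "?tan \<and> ?orth \<and> ?flat" by blast
next
  assume "?tan \<and> ?orth \<and> ?flat"
  then have d: ?tan and ds: "mat_of d ** mat_of s = 0"
    using annihilates_of_zero_curvature[OF x s xs] by auto
  define Z where "Z = mat 1 - mat_of s ** pseudo_inverse (mat_of s)"
  note Z = kernel_projection_pseudo_inverse[OF transpose_mat_of[of s], folded Z_def]
  have sd: "mat_of s ** mat_of d = 0"
    using arg_cong[OF ds, of transpose] by (simp add: matrix_transpose_mul)
  have compress: "trace (mat_of a ** (Z ** mat_of h ** Z)) = inner a h"
    if "mat_of a ** mat_of s = 0" "mat_of s ** mat_of a = 0" for a h
  proof -
    have "trace (mat_of a ** (Z ** mat_of h ** Z)) = trace (mat_of a ** mat_of h ** Z)"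
      by (simp add: Z(5)[OF that(1)] matrix_mul_assoc)
    also have "\<dots> = trace (Z ** mat_of a ** mat_of h)"
      by (subst trace_mul_sym) (simp add: matrix_mul_assoc)
    finally show ?thesis by (simp add: Z(4)[OF that(2)] inner_symmat_trace)
  qed
  show ?dual
  proof
    fix h assume "h \<in> tangent_cone psd_cone s \<inter> orth_compl x"
    then have h: "h \<in> tangent_cone psd_cone s" "inner h x = 0" by (auto simp: orth_compl_def)
    \<comment> \<open>Compressing \<open>h\<close> to the kernel of \<open>s\<close> makes it a genuine element of the cone and does
      not change its inner products with \<open>d\<close> and \<open>x\<close>.\<close>
    define k where "k = Sym (Z ** mat_of h ** Z)"
    have psd: "psd_matrix (Z ** mat_of h ** Z)"
      by (rule tangent_psd_compression[OF s h(1) Z(1,2)])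
    then have k: "mat_of k = Z ** mat_of h ** Z"
      by (simp add: k_def mat_of_Sym psd_matrix_def)
    then have "k \<in> psd_cone" using psd by (simp add: psd_cone_iff)
    moreover have "inner k x = 0"
      using compress[OF complementary_psd_product[OF x s xs], of h] h(2)
      by (simp add: inner_commute[of k] inner_commute[of x h] inner_symmat_trace[of x k] k)
    ultimately have "0 \<le> inner k d" using d by (simp add: tangent_psd_cone_iff[OF x])
    also have "inner k d = inner d h"
      using compress[OF ds sd, of h] by (simp add: inner_commute[of k] inner_symmat_trace[of d k] k)
    finally show "0 \<le> inner d h" .
  qed
qed


section \<open>The directional derivative of the support function of a polyhedron\<close>

text \<open>
  Hoffman-type estimate at the face exposed by \<open>v\<close>. Near \<open>x\<close> the polyhedron is a polytope, so
  only the finitely many vertices of that polytope have to be tested, and each of them yields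
  one lower bound for \<open>M\<close>; convexity and scaling from \<open>x\<close> extend the bound to all of \<open>P\<close>.
\<close>

lemma polyhedron_exposed_face_majorant:
  fixes P :: "'a::euclidean_space set"
  assumes P: "polyhedron P" "x \<in> P"
    and nonpos: "\<And>p. p \<in> P \<Longrightarrow> inner v (p - x) \<le> 0"
    and face: "\<And>p. p \<in> P \<Longrightarrow> inner v (p - x) = 0 \<Longrightarrow> inner w (p - x) \<le> 0"
  obtains M where "0 \<le> M" "\<And>p. p \<in> P \<Longrightarrow> inner w (p - x) \<le> - M * inner v (p - x)"
proof -
  let ?B = "cbox (x - One) (x + One)"
  have "polytope (?B \<inter> P)" by (rule polytope_Int_polyhedron[OF polytope_interval P(1)])
  then obtain V where V: "finite V" "?B \<inter> P = convex hull V" by (auto simp: polytope_def)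
  define M where "M = Max (insert 0 ((\<lambda>p. inner w (p - x) / - inner v (p - x)) ` V))"
  have M0: "0 \<le> M" unfolding M_def using V(1) by (intro Max_ge) auto
  have vertex: "inner w (p - x) \<le> - M * inner v (p - x)" if "p \<in> V" for p
  proof -
    have p: "p \<in> P" using V(2) that hull_subset[of V convex] by blast
    show ?thesis
    proof (cases "inner v (p - x) = 0")
      case True
      then show ?thesis using face[OF p] by simp
    next
      case False
      then have neg: "inner v (p - x) < 0" using nonpos[OF p] by simp
      have "inner w (p - x) / - inner v (p - x) \<le> M"
        unfolding M_def using V(1) that by (intro Max_ge) auto
      then show ?thesis using neg by (simp add: field_simps)
    qed
  qed
  define a where "a = w + M *\<^sub>R v"
  have "V \<subseteq> {p. inner a p \<le> inner a x}"
    using vertex by (auto simp: a_def inner_add_left inner_diff_right algebra_simps)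
  then have "convex hull V \<subseteq> {p. inner a p \<le> inner a x}"
    by (intro hull_minimal convex_halfspace_le)
  then have local: "inner a (p - x) \<le> 0" if "p \<in> ?B" "p \<in> P" for p
    using V(2) that by (auto simp: inner_diff_right)
  have "inner a (p - x) \<le> 0" if p: "p \<in> P" for p
  proof -
    define e where "e = 1 / (1 + norm (p - x))"
    have pos: "0 < 1 + norm (p - x)" using norm_ge_zero[of "p - x"] by linarith
    then have e: "0 < e" "e \<le> 1" by (simp_all add: e_def)
    have "x + e *\<^sub>R (p - x) \<in> P"
      using convexD_alt[OF polyhedron_imp_convex[OF P(1)] P(2) p, of e] e
      by (simp add: algebra_simps)
    moreover have "\<bar>inner (e *\<^sub>R (p - x)) i\<bar> \<le> 1" if "i \<in> Basis" for i
    proof -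
      have "\<bar>inner (e *\<^sub>R (p - x)) i\<bar> \<le> norm (e *\<^sub>R (p - x))" by (rule Basis_le_norm[OF that])
      also have "\<dots> = norm (p - x) / (1 + norm (p - x))" using pos by (simp add: e_def)
      also have "\<dots> \<le> 1" using pos by simp
      finally show ?thesis .
    qed
    then have "x + e *\<^sub>R (p - x) \<in> ?B"
      by (auto simp: mem_box inner_add_left inner_diff_left abs_le_iff)
    ultimately have "inner a (e *\<^sub>R (p - x)) \<le> 0" using local by fastforce
    then show ?thesis using e by (simp add: mult_le_0_iff)
  qed
  then have "inner w (p - x) \<le> - M * inner v (p - x)" if "p \<in> P" for p
    using that by (force simp: a_def inner_add_left)
  with M0 show thesis by (rule that)
qed

lemma monotone_tendsto_at_right_INF:
  fixes g :: "real \<Rightarrow> ereal"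
  assumes "\<And>s t. 0 < s \<Longrightarrow> s \<le> t \<Longrightarrow> g s \<le> g t"
  shows "(g \<longlongrightarrow> (INF t\<in>{0<..}. g t)) (at_right 0)"
proof (rule order_tendstoI)
  fix a assume a: "a < (INF t\<in>{0<..}. g t)"
  show "eventually (\<lambda>t. a < g t) (at_right 0)"
    using eventually_at_right_less[of 0]
    by eventually_elim (use a in \<open>auto intro: less_le_trans INF_lower\<close>)
next
  fix a assume "(INF t\<in>{0<..}. g t) < a"
  then obtain t where t: "0 < t" "g t < a" by (auto simp: INF_less_iff)
  show "eventually (\<lambda>t. g t < a) (at_right 0)"
    using eventually_at_right_real[OF t(1)]
  proof eventually_elim
    case (elim r)
    then have "g r \<le> g t" by (intro assms) auto
    then show "g r < a" using t(2) by (rule le_less_trans)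
  qed
qed

lemma theta_difference_quotient:
  assumes x: "x \<in> P" and v: "v \<in> normal_cone P x" and t: "0 < t"
  shows "(theta P (- v + t *\<^sub>R u) - theta P (- v)) / ereal t =
    (SUP p\<in>P. ereal (inner v (p - x) / t - inner u p))"
proof -
  have ne: "P \<noteq> {}" using x by blast
  have "theta P (- v) = ereal (inner v x)"
    unfolding theta_def support_fun_def
    using x v by (intro antisym SUP_least SUP_upper2[of x]) (auto simp: normal_cone_def inner_diff_right)
  then have "theta P (- v + t *\<^sub>R u) - theta P (- v) =
      (SUP p\<in>P. ereal (inner (v - t *\<^sub>R u) p) - ereal (inner v x))"
    using SUP_ereal_minus_left[OF ne, of "ereal (inner v x)" "\<lambda>p. ereal (inner (v - t *\<^sub>R u) p)"]
    by (simp add: theta_def support_fun_def)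
  then have "(theta P (- v + t *\<^sub>R u) - theta P (- v)) / ereal t =
      ereal (1 / t) * (SUP p\<in>P. ereal (inner (v - t *\<^sub>R u) p) - ereal (inner v x))"
    using t by (simp add: divide_ereal_def mult.commute inverse_eq_divide)
  also have "\<dots> = (SUP p\<in>P. ereal (1 / t) * (ereal (inner (v - t *\<^sub>R u) p) - ereal (inner v x)))"
    using t by (intro Sup_ereal_mult_left'[OF ne]) simp
  also have "\<dots> = (SUP p\<in>P. ereal (inner v (p - x) / t - inner u p))"
    using t by (intro SUP_cong refl)
      (simp add: inner_diff_left inner_diff_right field_simps)
  finally show ?thesis .
qed

text \<open>
  The directional derivative is the support function of the face of \<open>P\<close> exposed by \<open>v\<close>, taken at
  \<open>- u\<close>; the set consists of those \<open>u\<close> for which \<open>x\<close> attains it. For a polyhedron the difference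
  quotient is even constant for small steps, which gives the inclusion that fails for general
  convex sets.
\<close>

lemma S_set_eq:
  assumes P: "polyhedron P" "x \<in> P" and v: "v \<in> normal_cone P x"
  shows "u \<in> S_set P x (- v) \<longleftrightarrow> (\<forall>p\<in>P. inner v (p - x) = 0 \<longrightarrow> 0 \<le> inner u (p - x))"
proof -
  have nonpos: "inner v (p - x) \<le> 0" if "p \<in> P" for p
    using v that P(2) by (simp add: normal_cone_def)
  define g where "g t = (SUP p\<in>P. ereal (inner v (p - x) / t - inner u p))" for t
  define L where "L = (INF t\<in>{0<..}. g t)"
  have g_ge: "ereal (- inner u p) \<le> g t" if "p \<in> P" "inner v (p - x) = 0" for p t
    unfolding g_def by (rule SUP_upper2[OF that(1)]) (simp add: that(2))
  have "g r \<le> g t" if "0 < r" "r \<le> t" for r t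
    unfolding g_def
  proof (rule SUP_mono)
    fix p assume p: "p \<in> P"
    have "inner v (p - x) / r \<le> inner v (p - x) / t"
      using nonpos[OF p] that by (intro divide_left_mono_neg) auto
    then show "\<exists>q\<in>P. ereal (inner v (p - x) / r - inner u p) \<le> ereal (inner v (q - x) / t - inner u q)"
      using p by (intro bexI[of _ p]) simp_all
  qed
  then have "(g \<longlongrightarrow> L) (at_right 0)" unfolding L_def by (rule monotone_tendsto_at_right_INF)
  moreover have "eventually (\<lambda>t. g t = (theta P (- v + t *\<^sub>R u) - theta P (- v)) / ereal t) (at_right 0)"
    using eventually_at_right_less[of 0]
    by eventually_elim (simp only: g_def theta_difference_quotient[OF P(2) v])
  ultimately have "((\<lambda>t. (theta P (- v + t *\<^sub>R u) - theta P (- v)) / ereal t) \<longlongrightarrow> L) (at_right 0)"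
    by (rule Lim_transform_eventually)
  then have deriv: "dir_deriv (theta P) (- v) u = L"
    unfolding dir_deriv_def by (intro tendsto_Lim) (simp_all add: trivial_limit_at_right_real)
  have "u \<in> S_set P x (- v) \<longleftrightarrow> L = ereal (- inner u x)"
    by (cases L) (auto simp: S_set_def deriv)
  also have "\<dots> \<longleftrightarrow> (\<forall>p\<in>P. inner v (p - x) = 0 \<longrightarrow> 0 \<le> inner u (p - x))"
  proof
    assume L: "L = ereal (- inner u x)"
    show "\<forall>p\<in>P. inner v (p - x) = 0 \<longrightarrow> 0 \<le> inner u (p - x)"
    proof (intro ballI impI)
      fix p assume "p \<in> P" "inner v (p - x) = 0"
      then have "ereal (- inner u p) \<le> L" unfolding L_def by (intro INF_greatest g_ge)
      then show "0 \<le> inner u (p - x)" by (simp add: L inner_diff_right)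
    qed
  next
    assume "\<forall>p\<in>P. inner v (p - x) = 0 \<longrightarrow> 0 \<le> inner u (p - x)"
    then obtain M where M: "0 \<le> M" "\<And>p. p \<in> P \<Longrightarrow> inner (- u) (p - x) \<le> - M * inner v (p - x)"
      using polyhedron_exposed_face_majorant[OF P nonpos, of "- u"] by auto
    \<comment> \<open>For a step length of at most \<open>1 / M\<close> the supremum is attained at \<open>x\<close>; \<open>M\<close> may be zero.\<close>
    have "g (1 / (M + 1)) \<le> ereal (- inner u x)"
      unfolding g_def
    proof (rule SUP_least)
      fix p assume p: "p \<in> P"
      have "inner v (p - x) / (1 / (M + 1)) = M * inner v (p - x) + inner v (p - x)"
        by (simp add: algebra_simps)
      then show "ereal (inner v (p - x) / (1 / (M + 1)) - inner u p) \<le> ereal (- inner u x)"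
        using M(2)[OF p] nonpos[OF p] by (simp add: inner_diff_right)
    qed
    moreover have "L \<le> g (1 / (M + 1))" unfolding L_def using M(1) by (intro INF_lower) simp
    moreover have "ereal (- inner u x) \<le> L" unfolding L_def using P(2) by (intro INF_greatest g_ge) auto
    ultimately show "L = ereal (- inner u x)" by simp
  qed
  finally show ?thesis .
qed

text \<open>
  The set contains \<open>v\<close>, \<open>- v\<close> and the negative of the normal cone, which forces \<open>d\<close> to be tangent and
  orthogonal to \<open>v\<close>. Conversely the majorant puts \<open>M v - u\<close> into the normal cone of \<open>P\<close> for every
  \<open>u\<close> in the set.
\<close>

lemma dual_of_S_set:
  assumes P: "polyhedron P" "x \<in> P" and v: "v \<in> normal_cone P x"
  shows "(\<forall>u\<in>S_set P x (- v). 0 \<le> inner d u) \<longleftrightarrow> d \<in> tangent_cone P x \<and> inner v d = 0"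
proof
  assume dual: "\<forall>u\<in>S_set P x (- v). 0 \<le> inner d u"
  have "v \<in> S_set P x (- v)" "- v \<in> S_set P x (- v)" by (simp_all add: S_set_eq[OF assms])
  then have "0 \<le> inner d v" "0 \<le> inner d (- v)" using dual by blast+
  then have "inner v d = 0" by (simp add: inner_commute)
  moreover have "inner n d \<le> 0" if "n \<in> normal_cone P x" for n
  proof -
    have "- n \<in> S_set P x (- v)" using that P(2) by (simp add: S_set_eq[OF assms] normal_cone_def)
    then have "0 \<le> inner d (- n)" using dual by blast
    then show ?thesis by (simp add: inner_commute)
  qed
  then have "d \<in> tangent_cone P x"
    by (simp add: tangent_cone_polar[OF polyhedron_imp_convex[OF P(1)] P(2)])
  ultimately show "d \<in> tangent_cone P x \<and> inner v d = 0" by blast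
next
  assume d: "d \<in> tangent_cone P x \<and> inner v d = 0"
  have nonpos: "inner v (p - x) \<le> 0" if "p \<in> P" for p
    using v that P(2) by (simp add: normal_cone_def)
  show "\<forall>u\<in>S_set P x (- v). 0 \<le> inner d u"
  proof
    fix u assume "u \<in> S_set P x (- v)"
    then have "inner (- u) (p - x) \<le> 0" if "p \<in> P" "inner v (p - x) = 0" for p
      using that by (simp add: S_set_eq[OF assms])
    then obtain M where M: "\<And>p. p \<in> P \<Longrightarrow> inner (- u) (p - x) \<le> - M * inner v (p - x)"
      using polyhedron_exposed_face_majorant[OF P nonpos, of "- u"] by blast
    have "inner (M *\<^sub>R v - u) d \<le> 0"
      using d M by (intro tangent_cone_halfspace[of d P x]) (force simp: inner_diff_left)+
    then show "0 \<le> inner d u" using d by (simp add: inner_diff_left inner_commute[of d u])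
  qed
qed


section \<open>The equivalence\<close>

text \<open>
  On the kernel of \<open>A\<close> the gradient acts as \<open>s - v\<close>. Both parts are nonnegative on the tangent
  cones, so their sum vanishes only if each of them does.
\<close>

lemma critical_cone_iff:
  fixes Q :: "('p::finite) symmat \<Rightarrow> 'p symmat" and A :: "'p symmat \<Rightarrow> real ^ ('m::finite)"
  assumes "linear A" and x: "x \<in> psd_cone" and s: "s \<in> psd_cone" and sx: "inner s x = 0"
    and "x \<in> P" and v: "v \<in> normal_cone P x"
    and kkt: "Q x + c = adjoint A y - v + s"
  shows "(dx, du) \<in> critical_cone Q c A P x x \<longleftrightarrow>
    du = dx \<and> A dx = 0 \<and> dx \<in> tangent_cone psd_cone x \<and> inner s dx = 0 \<and>
    dx \<in> tangent_cone P x \<and> inner v dx = 0"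
proof -
  have grad: "inner (Q x + c) dx = inner s dx - inner v dx" if "A dx = 0"
    using adjoint_works[OF assms(1), of dx y] that
    by (simp add: kkt inner_add_left inner_diff_left inner_commute[of "adjoint A y"])
  have "0 \<le> inner s dx" if "dx \<in> tangent_cone psd_cone x"
    using that s sx unfolding tangent_psd_cone_iff[OF x] by blast
  moreover have "inner v dx \<le> 0" if "dx \<in> tangent_cone P x"
    using that v \<open>x \<in> P\<close> by (auto simp: normal_cone_def intro: tangent_cone_halfspace)
  ultimately have "inner s dx = inner v dx \<longleftrightarrow> inner s dx = 0 \<and> inner v dx = 0"
    if "dx \<in> tangent_cone psd_cone x" "dx \<in> tangent_cone P x"
    using that by fastforce
  moreover have "inner (Q x + c) dx = 0 \<longleftrightarrow> inner s dx = inner v dx" if "A dx = 0"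
    using grad[OF that] by simp
  ultimately show ?thesis
    unfolding critical_cone_def mem_Collect_eq prod.case right_minus_eq by blast
qed

lemma dual_srcq_iff_trivial_dual_cone:
  fixes Q :: "('p::finite) symmat \<Rightarrow> 'p symmat" and A :: "'p symmat \<Rightarrow> real ^ ('m::finite)"
  assumes Q: "linear Q" "\<forall>d e. inner (Q d) e = inner d (Q e)" and A: "linear A"
    and W: "subspace W" "range Q \<subseteq> W"
    and x: "x \<in> psd_cone" and s: "s \<in> psd_cone" and xs: "inner x s = 0"
    and P: "polyhedron P" "x \<in> P" and v: "v \<in> normal_cone P x"
  shows "dual_srcq Q A P W x s (- v) \<longleftrightarrow>
    (\<forall>d. d \<in> tangent_cone psd_cone x \<and> inner s d = 0 \<and>
      trace (mat_of s ** (mat_of d ** pseudo_inverse (mat_of x) ** mat_of d)) = 0 \<and>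
      d \<in> tangent_cone P x \<and> inner v d = 0 \<and> A d = 0 \<and> Q d = 0 \<longrightarrow> d = 0)"
proof -
  define T where "T = tangent_cone psd_cone s \<inter> orth_compl x"
  define U where "U = S_set P x (- v)"
  define K where "K = {h + u + adjoint A y - Q w | h u y w. h \<in> T \<and> u \<in> U \<and> w \<in> W}"
  note U = S_set_eq[OF P v, folded U_def]
  interpret Q: linear Q by (rule Q(1))
  interpret A': linear "adjoint A" by (rule adjoint_linear[OF A])
  have KI: "h + u + adjoint A y - Q w \<in> K" if "h \<in> T" "u \<in> U" "w \<in> W" for h u y w
    using that by (auto simp: K_def)
  have T0: "0 \<in> T" by (simp add: T_def tangent_psd_cone_iff[OF s] orth_compl_def)
  have U0: "0 \<in> U" by (simp add: U)
  have W0: "0 \<in> W" by (rule subspace_0[OF W(1)])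
  have T_add: "h + h' \<in> T" if "h \<in> T" "h' \<in> T" for h h'
    using that by (simp add: T_def tangent_psd_cone_iff[OF s] orth_compl_def inner_add_left inner_add_right)
  have U_add: "u + u' \<in> U" if "u \<in> U" "u' \<in> U" for u u'
    using that by (simp add: U inner_add_left)
  have T_scale: "t *\<^sub>R h \<in> T" if "0 \<le> t" "h \<in> T" for t h
    using that by (simp add: T_def tangent_psd_cone_iff[OF s] orth_compl_def)
  have U_scale: "t *\<^sub>R u \<in> U" if "0 \<le> t" "u \<in> U" for t u
    using that by (simp add: U)
  have K_cone: "K = UNIV \<longleftrightarrow> (\<forall>d. (\<forall>k\<in>K. 0 \<le> inner d k) \<longrightarrow> d = 0)"
  proof (rule convex_cone_eq_UNIV_iff)
    show "0 \<in> K" using KI[OF T0 U0 W0, of 0] by (simp add: Q.zero A'.zero)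
  next
    fix a b assume "a \<in> K" "b \<in> K"
    then obtain h u y w h' u' y' w' where
      ab: "a = h + u + adjoint A y - Q w" "b = h' + u' + adjoint A y' - Q w'"
      and "h \<in> T" "u \<in> U" "w \<in> W" "h' \<in> T" "u' \<in> U" "w' \<in> W"
      unfolding K_def by blast
    then have "(h + h') + (u + u') + adjoint A (y + y') - Q (w + w') \<in> K"
      by (intro KI T_add U_add subspace_add[OF W(1)])
    then show "a + b \<in> K" unfolding ab by (simp add: Q.add A'.add algebra_simps)
  next
    fix t :: real and a assume t: "0 \<le> t" and "a \<in> K"
    then obtain h u y w where
      a: "a = h + u + adjoint A y - Q w" and "h \<in> T" "u \<in> U" "w \<in> W"
      unfolding K_def by blast
    then have "t *\<^sub>R h + t *\<^sub>R u + adjoint A (t *\<^sub>R y) - Q (t *\<^sub>R w) \<in> K"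
      by (intro KI T_scale[OF t] U_scale[OF t] subspace_scale[OF W(1)])
    then show "t *\<^sub>R a \<in> K" unfolding a by (simp add: Q.scale A'.scale algebra_simps)
  qed
  have K_dual: "(\<forall>k\<in>K. 0 \<le> inner d k) \<longleftrightarrow>
      (\<forall>h\<in>T. 0 \<le> inner d h) \<and> (\<forall>u\<in>U. 0 \<le> inner d u) \<and> A d = 0 \<and> Q d = 0" for d
  proof
    assume dual: "\<forall>k\<in>K. 0 \<le> inner d k"
    have *: "0 \<le> inner d (h + u + adjoint A y - Q w)" if "h \<in> T" "u \<in> U" "w \<in> W" for h u y w
      using dual KI[OF that] by blast
    have "\<forall>h\<in>T. 0 \<le> inner d h" using *[OF _ U0 W0, of _ 0] by (simp add: Q.zero A'.zero)
    moreover have "\<forall>u\<in>U. 0 \<le> inner d u" using *[OF T0 _ W0, of _ 0] by (simp add: Q.zero A'.zero)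
    moreover have "0 \<le> - inner (A d) (A d)"
      using *[OF T0 U0 W0, of "- A d"] adjoint_works[OF A, of d "A d"] by (simp add: Q.zero A'.neg)
    then have "A d = 0" by (metis inner_ge_zero inner_eq_zero_iff neg_0_le_iff_le order_antisym)
    \<comment> \<open>\<open>Q d\<close> lies in \<open>W\<close> by assumption, so it may be used as a test direction.\<close>
    moreover have "0 \<le> - inner (Q d) (Q d)"
      using *[OF T0 U0, of "Q d" 0] W(2) Q(2) by (simp add: A'.zero range_subsetD)
    then have "Q d = 0" by (metis inner_ge_zero inner_eq_zero_iff neg_0_le_iff_le order_antisym)
    ultimately show "(\<forall>h\<in>T. 0 \<le> inner d h) \<and> (\<forall>u\<in>U. 0 \<le> inner d u) \<and> A d = 0 \<and> Q d = 0"
      by blast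
  next
    assume d: "(\<forall>h\<in>T. 0 \<le> inner d h) \<and> (\<forall>u\<in>U. 0 \<le> inner d u) \<and> A d = 0 \<and> Q d = 0"
    have "inner d (adjoint A y) = 0" "inner d (Q w) = 0" for y w
      using d Q(2) by (simp_all add: adjoint_works[OF A]) (metis inner_zero_left)
    then show "\<forall>k\<in>K. 0 \<le> inner d k"
      using d by (auto simp: K_def inner_add_right inner_diff_right)
  qed
  have "dual_srcq Q A P W x s (- v) \<longleftrightarrow> K = UNIV"
    by (simp add: dual_srcq_def K_def T_def U_def)
  also have "\<dots> \<longleftrightarrow> (\<forall>d. ((d \<in> tangent_cone psd_cone x \<and> inner s d = 0 \<and>
      trace (mat_of s ** (mat_of d ** pseudo_inverse (mat_of x) ** mat_of d)) = 0) \<and>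
      (d \<in> tangent_cone P x \<and> inner v d = 0) \<and> A d = 0 \<and> Q d = 0) \<longrightarrow> d = 0)"
    by (simp only: K_cone K_dual T_def U_def dual_of_tangent_cone_inter_orth_compl[OF x s xs]
        dual_of_S_set[OF P v])
  finally show ?thesis by (simp only: conj_assoc)
qed

theorem corollary5p1:
  fixes Q :: "('p::finite) symmat \<Rightarrow> 'p symmat"
    and A :: "'p symmat \<Rightarrow> real ^ ('m::finite)"
    and c :: "'p symmat" and b :: "real ^ 'm"
    and P W :: "'p symmat set"
    and x u s z v :: "'p symmat" and y :: "real ^ 'm"
  assumes "linear Q"
    and "\<forall>d e. inner (Q d) e = inner d (Q e)"
    and "\<forall>d. 0 \<le> inner d (Q d)"
    and "linear A"
    and "P \<noteq> {}" and "polyhedron P"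
    and "subspace W" and "range Q \<subseteq> W"
    and "primal_optimal Q c A b P x u"
    and "multipliers Q c A b P x u = {(s, y, z, v)}"
  shows "primal_sosc Q c A P x u s \<longleftrightarrow> dual_srcq Q A P W x s z"
proof -
  have feas: "u = x" "x \<in> psd_cone" "x \<in> P"
    using assms(9) by (auto simp: primal_optimal_def primal_feasible_def)
  have "(s, y, z, v) \<in> multipliers Q c A b P x u" using assms(10) by simp
  then have mult: "Q x + c - adjoint A y - z - s = 0" "z + v = 0"
      "s \<in> normal_cone nsd_cone (- x)" "v \<in> normal_cone P x"
    by (auto simp: multipliers_def feas(1))
  have z: "z = - v" using mult(2) by (simp add: eq_neg_iff_add_eq_0)
  have kkt: "Q x + c = adjoint A y - v + s" using mult(1) by (simp add: z algebra_simps)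
  have s: "s \<in> psd_cone" "inner s x = 0" "inner x s = 0"
    using mult(3) by (simp_all add: normal_cone_nsd_cone[OF feas(2)] inner_commute)
  let ?curv = "\<lambda>d. trace (mat_of s ** (mat_of d ** pseudo_inverse (mat_of x) ** mat_of d))"
  have form: "inner (Q d) d + 2 * ?curv d > 0 \<longleftrightarrow> \<not> (Q d = 0 \<and> ?curv d = 0)" for d
  proof -
    have "0 \<le> inner (Q d) d" using assms(3) by (simp add: inner_commute)
    moreover have "0 \<le> ?curv d" by (rule curvature_term_nonneg[OF feas(2) s(1)])
    moreover have "Q d = 0" if "inner (Q d) d = 0"
      using psd_form_eq_0[of Q d] assms(1,2,3) that by (simp add: inner_commute)
    ultimately show ?thesis by (cases "inner (Q d) d = 0") auto
  qed
  note crit = critical_cone_iff[where Q = Q and c = c, OF assms(4) feas(2) s(1,2) feas(3) mult(4) kkt]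
  have "primal_sosc Q c A P x u s \<longleftrightarrow>
      (\<forall>d. A d = 0 \<and> d \<in> tangent_cone psd_cone x \<and> inner s d = 0 \<and>
        d \<in> tangent_cone P x \<and> inner v d = 0 \<and> d \<noteq> 0 \<longrightarrow> \<not> (Q d = 0 \<and> ?curv d = 0))"
    unfolding primal_sosc_def feas(1) form by (auto simp: crit)
  also have "\<dots> \<longleftrightarrow> dual_srcq Q A P W x s z"
    unfolding z dual_srcq_iff_trivial_dual_cone[OF assms(1,2,4,7,8) feas(2) s(1,3) assms(6) feas(3) mult(4)]
    by blast
  finally show ?thesis .
qed

end
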